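(* Let $n\ge4$ be an even integer and let $x_0\in[-\tfrac14,\tfrac14]+\mathbb{Z}$. Then there exists $\lambda>0$ such that $Z_\lambda h_n(x_0,\tfrac12)=0$ and therefore $$Z_\lambda h_n(\pm x_0+k,\tfrac12+\ell)=0\quad\text{for all }k,\ell\in\mathbb{Z}.$$
   Context: For $n\in\mathbb{Z}_{\ge 0}$ the Hermite function is $h_n(x) = (-1)^n c_n^{-1/2} e^{\pi x^2}\frac{d^n}{dx^n}e^{-2\pi x^2}$, $x\in\mathbb{R}$, with $c_n=(2\pi)^n 2^{n-1/2} n!$. For $\lambda>0$ the Zak transform is $Z_\lambda f(x,\gamma)=\sqrt{\lambda}\sum_{k\in\mathbb{Z}}f(\lambda(x+k))e^{-2\pi i k\gamma}$, $x,\gamma\in\mathbb{R}$. *)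

theory Defs
  imports "HOL-Analysis.Analysis"
begin

definition hermite_const :: "nat \<Rightarrow> real" where
  "hermite_const n = (2 * pi) ^ n * 2 powr (real n - 1/2) * fact n"

definition hermite_fun :: "nat \<Rightarrow> real \<Rightarrow> real" where
  "hermite_fun n x =
     (-1) ^ n * hermite_const n powr (-1/2) * exp (pi * x\<^sup>2)
       * (deriv ^^ n) (\<lambda>t::real. exp (- 2 * pi * t\<^sup>2)) x"

(* The sum over the integers is unconditional summation, with value 0 if the family is not
   summable. For Schwartz functions f, such as the Hermite functions, it always converges
   absolutely when lam > 0. *)
definition zak :: "real \<Rightarrow> (real \<Rightarrow> complex) \<Rightarrow> real \<Rightarrow> real \<Rightarrow> complex" where
  "zak lam f x \<gamma> =
     of_real (sqrt lam)
       * (\<Sum>\<^sub>\<infinity>k::int. f (lam * (x + of_int k)) * exp (- 2 * of_real pi * \<i> * of_int k * of_real \<gamma>))"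

end

theory Submission
  imports Defs "HOL-Computational_Algebra.Polynomial"
begin

text \<open>
  Up to a positive constant and the dilation \<open>y = sqrt (2 * pi) * x\<close>, the Hermite function is
  \<open>u y = H y * exp (- y\<^sup>2 / 2)\<close> with the physicists' Hermite polynomial \<open>H\<close> of degree \<open>n\<close>. At a
  half-integer frequency the characters in the Zak transform are the signs \<open>(-1)\<^sup>k\<close>, so with
  \<open>A \<mu> a = (\<Sum>k. (-1)\<^sup>k * u (\<mu> * (k + a)))\<close> and \<open>u\<close> even, the claim for \<open>0 \<le> x \<le> 1/4\<close> is that
  \<open>F \<mu> = A \<mu> x - A \<mu> (1 - x)\<close> vanishes for some \<open>\<mu> > 0\<close>. All other \<open>x\<^sub>0\<close> reduce to this range by
  reflection and integer translation. As \<open>F\<close> is continuous, it suffices that it takes both signs.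

  Let \<open>z\<close> be the largest zero of \<open>u\<close> and \<open>p\<close> the critical point to its right. Past \<open>p\<close>, \<open>u\<close> is
  positive and decreasing, so \<open>0 \<le> A \<mu> a \<le> u (\<mu> * a)\<close> as soon as \<open>p \<le> \<mu> * a\<close>, as for any
  alternating series. Peeling off the first terms of \<open>F\<close> until the remaining arguments lie past \<open>p\<close>
  then determines its sign.

  If \<open>0 < x\<close>, then \<open>F \<mu> = u (\<mu> * x) - A \<mu> (1 + x) - A \<mu> (1 - x)\<close>, and because \<open>x \<le> 1/4\<close> the last two
  arguments are at least \<open>3 * \<mu> * x\<close>. At \<open>\<mu> = z / x\<close> the first term vanishes and \<open>F \<le> 0\<close>. At
  \<open>\<mu> = p / x\<close> the first term is \<open>u p\<close>, which outweighs the two others since \<open>u\<close> has fallen below half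
  of \<open>u p\<close> at \<open>2 * p\<close>; hence \<open>F \<ge> 0\<close>.

  If \<open>x = 0\<close>, then \<open>F \<mu> = u 0 - 2 * A \<mu> 1\<close> tends to \<open>u 0 \<noteq> 0\<close> as \<open>\<mu>\<close> grows, so the opposite sign has to
  be found at a moderate \<open>\<mu>\<close>. Here Sonin's inequality is used: among critical points in the
  oscillatory region, \<open>\<bar>u\<bar>\<close> is smallest at \<open>0\<close>. For \<open>u 0 > 0\<close>, \<open>\<mu> = p\<close> works because
  \<open>F p \<le> u 0 - 2 * u p + 2 * u (2 * p) \<le> u 0 - u p\<close>. For \<open>u 0 < 0\<close> one has \<open>n \<ge> 6\<close>, and there are two
  cases. If \<open>u (p / 2) \<le> 0\<close>, then \<open>\<mu> = p / 2\<close> puts \<open>u\<close> at its peak in the term with a plus sign. If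
  \<open>u (p / 2) > 0\<close>, then \<open>u\<close> has a negative minimum at some \<open>q\<close> in \<open>(p / 2, z)\<close>; with \<open>\<mu> = q\<close> the
  arguments \<open>2 * q, 3 * q, ...\<close> are past \<open>p\<close>, and \<open>F q \<ge> u 0 - 2 * u q \<ge> \<bar>u q\<bar>\<close>.

  What is needed of \<open>z\<close> and \<open>p\<close> (namely \<open>p \<le> 2 * z\<close>, \<open>n \<le> p\<^sup>2 < 2 * n + 1\<close>, and Gaussian decay past \<open>p\<close>)
  is collected in \<open>hermite_profile\<close>. It follows from Turan's inequality, which makes the ratio
  of consecutive Hermite polynomials grow at least like \<open>2 * y\<close>.
\<close>

section \<open>Hermite polynomials\<close>

primrec hermite_poly :: "nat \<Rightarrow> real poly" where
  "hermite_poly 0 = 1"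
| "hermite_poly (Suc n) = [:0, 2:] * hermite_poly n - pderiv (hermite_poly n)"

lemma pderiv_hermite_poly_Suc:
  "pderiv (hermite_poly (Suc n)) = smult (2 * real (Suc n)) (hermite_poly n)"
proof (induction n)
  case 0
  show ?case by (simp add: pderiv_mult pderiv_pCons pderiv_minus pderiv_diff numeral_eq_Suc)
next
  case (Suc n)
  have "pderiv (hermite_poly (Suc (Suc n))) =
     smult 2 (hermite_poly (Suc n)) + [:0,2:] * pderiv (hermite_poly (Suc n))
       - pderiv (pderiv (hermite_poly (Suc n)))"
    by (subst hermite_poly.simps(2)) (simp add: pderiv_diff pderiv_mult pderiv_pCons pderiv_smult algebra_simps del: hermite_poly.simps(2))
  also have "\<dots> = smult 2 (hermite_poly (Suc n))
       + smult (2 * real (Suc n)) ([:0,2:] * hermite_poly n - pderiv (hermite_poly n))"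
    unfolding Suc pderiv_smult by (simp only: smult_diff_right mult_smult_right add_diff_eq)
  also have "\<dots> = smult (2 * real (Suc (Suc n))) (hermite_poly (Suc n))"
    unfolding hermite_poly.simps(2)[symmetric]
    by (simp add: smult_add_left[symmetric] algebra_simps del: hermite_poly.simps(2))
  finally show ?case .
qed

definition hermite :: "nat \<Rightarrow> real \<Rightarrow> real" where
  "hermite n = poly (hermite_poly n)"

lemma continuous_on_hermite [continuous_intros]:
  "continuous_on S f \<Longrightarrow> continuous_on S (\<lambda>y. hermite n (f y))"
  unfolding hermite_def by (rule continuous_on_poly)

lemma hermite_rec:
  "hermite (Suc (Suc n)) y = 2 * y * hermite (Suc n) y - 2 * real (Suc n) * hermite n y"
  unfolding hermite_def
  by (subst hermite_poly.simps(2)) (simp add: pderiv_hermite_poly_Suc del: hermite_poly.simps(2))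

lemma hermite_0 [simp]: "hermite 0 y = 1"
  and hermite_Suc_0 [simp]: "hermite (Suc 0) y = 2 * y"
  by (simp_all add: hermite_def pderiv_1)

declare hermite_poly.simps(2) [simp del]

lemma hermite_has_derivative:
  "(hermite (Suc n) has_real_derivative 2 * real (Suc n) * hermite n y) (at y within S)"
  using poly_DERIV[of "hermite_poly (Suc n)" y, THEN has_field_derivative_at_within, of S]
  by (simp add: hermite_def pderiv_hermite_poly_Suc)

lemma hermite_parity: "hermite n (- y) = (-1) ^ n * hermite n y"
proof (induction n rule: less_induct)
  case (less n)
  consider "n = 0" | "n = Suc 0" | m where "n = Suc (Suc m)"
    by (metis not0_implies_Suc)
  then show ?case
  proof cases
    case 3
    then show ?thesis using less[of m] less[of "Suc m"]
      by (simp add: hermite_rec algebra_simps)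
  qed (auto)
qed

lemma hermite_even_0_nonzero: "hermite (2 * m) 0 \<noteq> 0"
  by (induction m) (simp_all add: hermite_rec del: One_nat_def)

lemma hermite_4_0: "hermite 4 0 = 12"
proof -
  have "(4::nat) = Suc (Suc (Suc (Suc 0)))" by simp
  then show ?thesis by (simp only: hermite_rec) simp
qed

text \<open>
  Turan's inequality. The Turan determinants \<open>D\<^sub>n = H\<^sub>n\<^sup>2 - H\<^sub>n\<^sub>+\<^sub>1 * H\<^sub>n\<^sub>-\<^sub>1\<close> satisfy
  \<open>D\<^sub>n\<^sub>+\<^sub>1 = 2 * n * D\<^sub>n + 2 * H\<^sub>n\<^sup>2\<close>, so they stay nonnegative.
\<close>

lemma turan: "hermite (Suc (Suc n)) y * hermite n y \<le> (hermite (Suc n) y)\<^sup>2"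
proof (induction n)
  case 0
  then show ?case by (simp add: hermite_rec power2_eq_square)
next
  case (Suc n)
  define a b c d where "a = hermite n y" and "b = hermite (Suc n) y"
    and "c = hermite (Suc (Suc n)) y" and "d = hermite (Suc (Suc (Suc n))) y"
  have c: "c = 2 * y * b - 2 * real (Suc n) * a" and d: "d = 2 * y * c - 2 * real (Suc (Suc n)) * b"
    unfolding a_def b_def c_def d_def by (rule hermite_rec)+
  have "c\<^sup>2 - d * b = 2 * real (Suc n) * (b\<^sup>2 - c * a) + 2 * b\<^sup>2"
    unfolding d unfolding c by (simp add: algebra_simps power2_eq_square)
  moreover have "b\<^sup>2 - c * a \<ge> 0"
    using Suc unfolding a_def b_def c_def by simp
  ultimately have "c\<^sup>2 - d * b \<ge> 0" by simp
  then show ?case unfolding a_def b_def c_def d_def by simp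
qed

text \<open>
  The derivative in the recursion has smaller degree, so each step doubles the leading coefficient.
\<close>

lemma hermite_lead_coeff: "degree (hermite_poly n) = n \<and> lead_coeff (hermite_poly n) > 0"
proof (induction n)
  case (Suc n)
  let ?h = "hermite_poly n"
  have nz: "?h \<noteq> 0" using Suc by auto
  have d: "degree ([:0,2:] * ?h) = Suc n"
    using nz Suc by (subst degree_mult_eq) auto
  have "degree (- pderiv ?h) < degree ([:0,2:] * ?h)"
    using d Suc by (simp add: degree_pderiv del: mult_pCons_left)
  then have "degree ([:0,2:] * ?h + - pderiv ?h) = Suc n"
      and "lead_coeff ([:0,2:] * ?h + - pderiv ?h) = lead_coeff ([:0,2:] * ?h)"
    using d degree_add_eq_left[of "- pderiv ?h" "[:0,2:] * ?h"]
      lead_coeff_add_le[of "- pderiv ?h" "[:0,2:] * ?h"] by (simp_all only: add.commute)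
  moreover have "lead_coeff ([:0,2:] * ?h) = 2 * lead_coeff ?h"
    by (simp only: lead_coeff_mult) simp
  ultimately show ?case using Suc unfolding hermite_poly.simps(2) diff_conv_add_uminus
    by (metis mult_pos_pos zero_less_numeral)
qed (simp)

lemma hermite_eventually_pos: "\<exists>b. \<forall>y\<ge>b. hermite n y > 0"
proof -
  obtain b where "\<forall>y\<ge>b. lead_coeff (hermite_poly n) \<le> poly (hermite_poly n) y"
    using poly_pinfty_gt_lc[of "hermite_poly n"] hermite_lead_coeff by blast
  then show ?thesis using hermite_lead_coeff[of n] unfolding hermite_def by (meson less_le_trans)
qed

text \<open>
  The largest zeros increase with the degree: at the largest zero of \<open>H\<^sub>n\<^sub>+\<^sub>1\<close> the three-term recurrence
  gives \<open>H\<^sub>n\<^sub>+\<^sub>2 = - 2 * (n + 1) * H\<^sub>n < 0\<close>, so \<open>H\<^sub>n\<^sub>+\<^sub>2\<close> still has to cross zero further right.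
  The positivity of all lower degrees is carried along because this argument consumes it, and because
  it makes the ratios of consecutive polynomials well-defined to the right of the zero.
\<close>

lemma hermite_largest_root:
  "\<exists>z\<ge>0. hermite (Suc n) z = 0 \<and> (\<forall>y>z. hermite (Suc n) y > 0) \<and> (\<forall>k\<le>n. \<forall>y\<ge>z. hermite k y > 0)"
proof (induction n)
  case 0
  show ?case by (rule exI[of _ 0]) auto
next
  case (Suc n)
  then obtain z where z: "z \<ge> 0" "hermite (Suc n) z = 0" "\<And>y. y > z \<Longrightarrow> hermite (Suc n) y > 0"
    "\<And>k y. k \<le> n \<Longrightarrow> y \<ge> z \<Longrightarrow> hermite k y > 0" by blast
  let ?h = "hermite (Suc (Suc n))"
  let ?R = "{y. ?h y = 0}"
  have neg: "?h z < 0" using z(2) z(4)[of n z] by (simp add: hermite_rec)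
  have "hermite_poly (Suc (Suc n)) \<noteq> 0" using hermite_lead_coeff[of "Suc (Suc n)"] by auto
  then have fin: "finite ?R" unfolding hermite_def by (rule poly_roots_finite)
  obtain b where b: "\<And>y. y \<ge> b \<Longrightarrow> ?h y > 0" using hermite_eventually_pos by blast
  have root: "\<exists>x\<in>?R. x > y" if "?h y < 0" for y
  proof -
    have "?h y < 0" "y < max b (y+1)" "?h (max b (y+1)) > 0"
      using that b[of "max b (y+1)"] by auto
    then show ?thesis using poly_IVT_pos[of y "max b (y+1)" "hermite_poly (Suc (Suc n))"]
      unfolding hermite_def by blast
  qed
  define x where "x = Max ?R"
  have x: "x \<in> ?R" "x > z" "\<And>t. t \<in> ?R \<Longrightarrow> t \<le> x"
  proof -
    obtain t where t: "t \<in> ?R" "t > z" using root[OF neg] by blast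
    show "x \<in> ?R" unfolding x_def using fin t by (intro Max_in) auto
    show le: "\<And>t. t \<in> ?R \<Longrightarrow> t \<le> x" unfolding x_def using fin by (intro Max_ge) auto
    show "x > z" using le[OF t(1)] t(2) by linarith
  qed
  have pos: "?h y > 0" if "y > x" for y
  proof (rule ccontr)
    assume "\<not> ?h y > 0"
    then consider "?h y = 0" | "?h y < 0" by linarith
    then show False
    proof cases
      case 1
      then show ?thesis using x(3)[of y] that by auto
    next
      case 2
      then show ?thesis using root[of y] x(3) that by fastforce
    qed
  qed
  show ?case
  proof (intro exI[of _ x] conjI allI impI)
    fix k y assume "k \<le> Suc n" "y \<ge> x"
    then show "hermite k y > 0" using z(3)[of y] z(4)[of k y] x(2) by (cases "k = Suc n") auto
  qed (use x pos z(1) in auto)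
qed


lemma hermite_deriv:
  assumes "n \<ge> 1"
  shows "(hermite n has_real_derivative 2 * real n * hermite (n - 1) y) (at y within S)"
  using hermite_has_derivative[of "n - 1"] assms by simp

section \<open>The oscillation profile of a Hermite function\<close>

text \<open>
  The function called \<open>u\<close> in the comments: an eigenfunction of the harmonic oscillator,
  \<open>u'' = (y\<^sup>2 - (2 * n + 1)) * u\<close>.
\<close>

definition psi :: "nat \<Rightarrow> real \<Rightarrow> real" where
  "psi n y = hermite n y * exp (- (y\<^sup>2) / 2)"

definition dpsi :: "nat \<Rightarrow> real \<Rightarrow> real" where
  "dpsi n y = (2 * real n * hermite (n - 1) y - y * hermite n y) * exp (- (y\<^sup>2) / 2)"

lemma psi_has_derivative:
  assumes "n \<ge> 1"
  shows "(psi n has_real_derivative dpsi n y) (at y within S)"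
  unfolding psi_def[abs_def] dpsi_def
  by (rule derivative_eq_intros hermite_deriv[OF assms] refl | simp)+ (simp add: algebra_simps)

lemma dpsi_has_derivative:
  assumes "n \<ge> 2"
  shows "(dpsi n has_real_derivative (y\<^sup>2 - (2 * real n + 1)) * psi n y) (at y within S)"
proof -
  obtain m where m: "n = Suc (Suc m)" using assms by (metis Suc_le_D Suc_le_mono numeral_2_eq_2)
  define a b c E where "a = hermite m y" and "b = hermite (Suc m) y" and "c = hermite n y"
    and "E = exp (- (y\<^sup>2) / 2)"
  have dc: "(hermite n has_real_derivative 2 * real n * b) (at y within S)"
    using hermite_has_derivative[of "Suc m" y S] by (simp add: m b_def)
  have db: "(hermite (n - 1) has_real_derivative 2 * (real n - 1) * a) (at y within S)"
    using hermite_has_derivative[of m y S] by (simp add: m a_def)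
  have dE: "((\<lambda>y. exp (- (y\<^sup>2) / 2)) has_real_derivative - y * E) (at y within S)"
    unfolding E_def by (auto intro!: derivative_eq_intros)
  have c: "c = 2 * y * b - 2 * (real n - 1) * a"
    using hermite_rec[of m y] by (simp add: a_def b_def c_def m)
  have "(dpsi n has_real_derivative
      (2 * real n * (2 * (real n - 1) * a) - (1 * c + 2 * real n * b * y)) * E
        + - y * E * (2 * real n * b - y * c)) (at y within S)"
    unfolding dpsi_def[abs_def]
    using DERIV_mult[OF DERIV_diff[OF DERIV_cmult[OF db, of "2 * real n"] DERIV_mult[OF DERIV_ident dc]] dE]
    by (simp add: m b_def c_def E_def)
  moreover have "(2 * real n * (2 * (real n - 1) * a) - (1 * c + 2 * real n * b * y)) * E
        + - y * E * (2 * real n * b - y * c) = (y\<^sup>2 - (2 * real n + 1)) * (c * E)"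
    unfolding c by (simp add: power2_eq_square algebra_simps)
  ultimately show ?thesis by (simp only: psi_def c_def E_def)
qed

lemma continuous_on_psi: "continuous_on S (psi n)"
  unfolding psi_def[abs_def] by (intro continuous_intros) auto

lemma psi_even:
  assumes "even n" shows "psi n (- y) = psi n y"
  using assms by (simp add: psi_def hermite_parity)

text \<open>
  The equation \<open>u'' = - Q * u\<close> with \<open>Q y = 2 * n + 1 - y\<^sup>2\<close> makes Sonin's function
  \<open>u\<^sup>2 + u'\<^sup>2 / Q\<close> nondecreasing on the part of the positive axis where \<open>Q > 0\<close>: its derivative is
  \<open>2 * y * u'\<^sup>2 / Q\<^sup>2\<close>. At a critical point it equals \<open>u\<^sup>2\<close>, and at \<open>0\<close> it is at least \<open>u\<^sup>2\<close>.
\<close>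

lemma sonin:
  assumes n: "n \<ge> 2" and c: "0 < c" "c\<^sup>2 < 2 * real n + 1" and crit: "dpsi n c = 0"
  shows "(psi n 0)\<^sup>2 \<le> (psi n c)\<^sup>2"
proof -
  define Q where "Q y = 2 * real n + 1 - y\<^sup>2" for y
  define S where "S y = (psi n y)\<^sup>2 + (dpsi n y)\<^sup>2 / Q y" for y
  have Q: "Q y > 0" if "0 \<le> y" "y \<le> c" for y
  proof -
    have "y\<^sup>2 \<le> c\<^sup>2" using that by (intro power_mono) auto
    then show ?thesis using c unfolding Q_def by linarith
  qed
  have "S 0 \<le> S c"
  proof (rule DERIV_nonneg_imp_nondecreasing[of 0 c S])
    fix y assume y: "0 \<le> y" "y \<le> c"
    have n1: "n \<ge> 1" using n by simp
    have dQ: "(Q has_real_derivative - 2 * y) (at y)"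
      unfolding Q_def[abs_def] by (rule derivative_eq_intros refl | simp)+
    have d2: "(dpsi n has_real_derivative - Q y * psi n y) (at y)"
      using dpsi_has_derivative[OF n, of y UNIV] by (simp add: Q_def algebra_simps)
    have "(S has_real_derivative 2 * psi n y * dpsi n y
          + (2 * dpsi n y * (- Q y * psi n y) * Q y - (dpsi n y)\<^sup>2 * (- 2 * y)) / (Q y * Q y)) (at y)"
      unfolding S_def[abs_def] using Q[OF y]
      by (auto intro!: derivative_eq_intros psi_has_derivative[OF n1] d2 dQ)
    moreover have "2 * psi n y * dpsi n y
          + (2 * dpsi n y * (- Q y * psi n y) * Q y - (dpsi n y)\<^sup>2 * (- 2 * y)) / (Q y * Q y)
        = 2 * y * (dpsi n y)\<^sup>2 / (Q y * Q y)"
      using Q[OF y] by (simp add: field_simps)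
    moreover have "2 * y * (dpsi n y)\<^sup>2 / (Q y * Q y) \<ge> 0" using y Q[OF y] by simp
    ultimately show "\<exists>d. (S has_real_derivative d) (at y) \<and> d \<ge> 0" by metis
  qed (use c in simp)
  moreover have "S 0 \<ge> (psi n 0)\<^sup>2" unfolding S_def Q_def by simp
  ultimately show ?thesis using crit by (simp add: S_def)
qed

text \<open>
  The derivative of \<open>H\<^sub>n\<^sub>+\<^sub>2 / H\<^sub>n\<^sub>+\<^sub>1\<close> exceeds \<open>2\<close> by a positive multiple of a Turan determinant.
\<close>

lemma hermite_ratio_growth:
  assumes pos: "\<And>y. y \<ge> s \<Longrightarrow> hermite (Suc n) y > 0" and "s \<le> t"
  shows "hermite (Suc (Suc n)) t / hermite (Suc n) t - hermite (Suc (Suc n)) s / hermite (Suc n) s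
           \<ge> 2 * (t - s)"
proof -
  define r where "r y = hermite (Suc (Suc n)) y / hermite (Suc n) y - 2 * y" for y
  have "r s \<le> r t"
  proof (rule DERIV_nonneg_imp_nondecreasing[OF \<open>s \<le> t\<close>])
    fix y assume "s \<le> y" "y \<le> t"
    then have b: "hermite (Suc n) y > 0" using pos by simp
    define a b c where "a = hermite n y" and "b = hermite (Suc n) y"
      and "c = hermite (Suc (Suc n)) y"
    have bp: "b > 0" using b by (simp add: b_def)
    have "(r has_real_derivative (2 * real (Suc (Suc n)) * b * b - c * (2 * real (Suc n) * a)) / (b * b) - 2) (at y)"
      unfolding r_def[abs_def] a_def b_def c_def using b
      by (auto intro!: derivative_eq_intros hermite_has_derivative)
    moreover have "(2 * real (Suc (Suc n)) * b * b - c * (2 * real (Suc n) * a)) / (b * b) - 2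
        = 2 * real (Suc n) * (b\<^sup>2 - c * a) / (b * b)"
      using bp by (simp add: field_simps power2_eq_square)
    moreover have "2 * real (Suc n) * (b\<^sup>2 - c * a) / (b * b) \<ge> 0"
      using turan[of n y] bp by (simp add: a_def b_def c_def)
    ultimately show "\<exists>d. (r has_real_derivative d) (at y) \<and> d \<ge> 0" by metis
  qed
  then show ?thesis unfolding r_def by simp
qed

text \<open>
  The geometry of \<open>u\<close> near its last zero \<open>z\<close> and last critical point \<open>p\<close>. The critical points to the
  right of \<open>z\<close> are the solutions of \<open>y * r y = 2 * n\<close> for the ratio \<open>r = H\<^sub>n / H\<^sub>n\<^sub>-\<^sub>1\<close>, and
  \<open>H\<^sub>n' = (2 * n / r) * H\<^sub>n\<close>. Growth of \<open>r\<close> from \<open>r z = 0\<close> together with the lower bound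
  \<open>z\<^sup>2 \<ge> n - 3/2 \<ge> n / 2\<close> forces a critical point no later than \<open>2 * z\<close>. Past \<open>p\<close> growth of \<open>r\<close> gives
  \<open>H\<^sub>n' \<le> p * H\<^sub>n\<close>, so \<open>H\<^sub>n y * exp (- p * y)\<close> decreases; multiplying by the Gaussian yields the stated
  decay of \<open>u\<close>.
\<close>

lemma hermite_profile:
  assumes n: "n \<ge> 4"
  obtains z p where "0 < z" "z < p" "p \<le> 2 * z" "psi n z = 0" "dpsi n z > 0"
    "\<And>y. y > z \<Longrightarrow> psi n y > 0" "dpsi n p = 0" "real n \<le> p\<^sup>2" "p\<^sup>2 < 2 * real n + 1"
    "\<And>t y. p \<le> t \<Longrightarrow> t \<le> y \<Longrightarrow> psi n y \<le> psi n t * exp ((y - t) * (p - (y + t) / 2))"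
proof -
  obtain m where m: "n = Suc (Suc m)" "m \<ge> 2"
    by (metis One_nat_def Suc_1 Suc_le_D Suc_le_mono assms eval_nat_numeral(2) numeral_3_eq_3 semiring_norm(26-28))
  let ?H = "hermite n" and ?G = "hermite (Suc m)" and ?F = "hermite m"
  have nm: "n - 1 = Suc m" "real n \<ge> 4" using m n by auto
  obtain z where z: "z \<ge> 0" "?H z = 0" "\<And>y. y > z \<Longrightarrow> ?H y > 0"
      and lower: "\<And>k y. k \<le> Suc m \<Longrightarrow> y \<ge> z \<Longrightarrow> hermite k y > 0"
    using hermite_largest_root[of "Suc m"] unfolding m(1) by blast
  have rec: "?H y = 2 * y * ?G y - 2 * (real n - 1) * ?F y" for y
    using hermite_rec[of m y] m(1) by simp
  \<comment> \<open>Three steps of the recurrence downwards from \<open>H\<^sub>n z = 0\<close>, using that the lower degrees are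
      positive at \<open>z\<close>.\<close>
  have zn: "real n - 3 / 2 \<le> z\<^sup>2"
  proof -
    obtain j where j: "m = Suc (Suc j)" using m(2) by (metis Suc_le_D Suc_le_mono numeral_2_eq_2)
    let ?E = "hermite (Suc j)" and ?D = "hermite j"
    have p: "?G z > 0" "?F z > 0" "?E z > 0" "?D z > 0" using lower j by auto
    have r1: "z * ?G z = (real n - 1) * ?F z" using rec[of z] z(2) by (simp add: algebra_simps)
    have r2: "?G z = 2 * z * ?F z - 2 * (real n - 2) * ?E z"
      using hermite_rec[of "Suc j" z] j m(1) by simp
    have "?F z = 2 * z * ?E z - 2 * real (Suc j) * ?D z"
      using hermite_rec[of "j" z] j by simp
    moreover have "2 * real (Suc j) * ?D z \<ge> 0" using p by simp
    ultimately have r3: "?F z \<le> 2 * z * ?E z" by linarith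
    have "(real n - 1) * ?F z = 2 * z\<^sup>2 * ?F z - (real n - 2) * (2 * z * ?E z)"
      using r1 unfolding r2 by (simp add: algebra_simps power2_eq_square)
    also have "\<dots> \<le> 2 * z\<^sup>2 * ?F z - (real n - 2) * ?F z"
      using r3 nm by (intro diff_left_mono mult_left_mono) auto
    finally have "(2 * real n - 3) * ?F z \<le> 2 * z\<^sup>2 * ?F z" by (simp add: algebra_simps)
    then show ?thesis using p by simp
  qed
  have z0: "z > 0" using zn nm z(1) by (cases "z = 0") auto
  define r where "r y = ?H y / ?G y" for y
  have growth: "r t - r s \<ge> 2 * (t - s)" if "z \<le> s" "s \<le> t" for s t
    unfolding r_def m(1) using that lower[of "Suc m"] by (intro hermite_ratio_growth) auto
  have Gpos: "?G y > 0" if "y \<ge> z" for y using lower that by simp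
  have Hr: "?H y = r y * ?G y" if "y \<ge> z" for y using Gpos[OF that] by (simp add: r_def)
  \<comment> \<open>The zeros of \<open>w\<close> are the critical points of \<open>u\<close>; \<open>u' < 0\<close> where \<open>w > 0\<close>.\<close>
  define w where "w y = y * ?H y - 2 * real n * ?G y" for y
  have "w z < 0" unfolding w_def using z Gpos[of z] nm by simp
  moreover have "w (2 * z) \<ge> 0"
  proof -
    have "r (2 * z) \<ge> 2 * z" using growth[of z "2*z"] z z0 by (simp add: r_def)
    then have "2 * z * r (2 * z) \<ge> 2 * z * (2 * z)" using z0 by (intro mult_left_mono) auto
    moreover have "2 * z * (2 * z) \<ge> 2 * real n" using zn nm by (simp add: power2_eq_square)
    ultimately have "2 * z * r (2 * z) - 2 * real n \<ge> 0" by linarith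
    then have "(2 * z * r (2 * z) - 2 * real n) * ?G (2 * z) \<ge> 0" using Gpos[of "2*z"] z0 by simp
    then show ?thesis unfolding w_def Hr[of "2*z", OF order.trans[of z z]] using z0 Hr[of "2*z"] by (simp add: algebra_simps)
  qed
  moreover have "continuous_on {z..2*z} w" unfolding w_def[abs_def] by (intro continuous_intros)
  ultimately obtain p where p: "z \<le> p" "p \<le> 2 * z" "w p = 0"
    using IVT'[of w z 0 "2*z"] z0 by force
  have zp: "z < p" using p \<open>w z < 0\<close> by (cases "z = p") auto
  have pp: "p > 0" "?H p > 0" "?G p > 0" "?F p > 0" using zp z z0 lower[of _ p] by auto
  have crit: "p * ?H p = 2 * real n * ?G p" using p(3) unfolding w_def by simp
  have rp: "r p = 2 * real n / p" using crit pp by (simp add: r_def field_simps)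
  have pn: "real n \<le> p\<^sup>2"
  proof -
    have "2 * real n * ?G p \<le> p * (2 * p * ?G p)"
      unfolding crit[symmetric] rec[of p] using pp nm by (intro mult_left_mono) auto
    then show ?thesis using pp by (simp add: power2_eq_square)
  qed
  \<comment> \<open>Turan's inequality at \<open>p\<close>, with all terms expressed through \<open>H\<^sub>n p\<close> by means of the critical
      point equation, reads \<open>(n + 1) * p\<^sup>2 \<le> 2 * n\<^sup>2\<close>.\<close>
  have pu: "p\<^sup>2 < 2 * real n + 1"
  proof -
    have "4 * (real n)\<^sup>2 * ((2 * (real n - 1) * ?F p) * ?H p) \<le> 4 * (real n)\<^sup>2 * (2 * (real n - 1) * (?G p)\<^sup>2)"
      using turan[of m p] nm m(1) by (intro mult_left_mono) (auto simp: mult.assoc mult.commute[of "hermite m p"])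
    also have "\<dots> = 2 * (real n - 1) * (p * ?H p)\<^sup>2"
      unfolding crit by (simp add: power2_eq_square)
    also have "2 * (real n - 1) * ?F p = 2 * p * ?G p - ?H p" using rec[of p] by simp
    also have "4 * (real n)\<^sup>2 * ((2 * p * ?G p - ?H p) * ?H p) = 4 * real n * (p * (2 * real n * ?G p) - real n * ?H p) * ?H p"
      by (simp add: power2_eq_square algebra_simps)
    also have "\<dots> = (4 * real n * (p\<^sup>2 - real n)) * (?H p)\<^sup>2"
      unfolding crit[symmetric] by (simp add: power2_eq_square algebra_simps)
    finally have "(4 * real n * (p\<^sup>2 - real n)) * (?H p)\<^sup>2 \<le> (2 * (real n - 1) * p\<^sup>2) * (?H p)\<^sup>2"
      by (simp add: power_mult_distrib algebra_simps)
    then have "4 * real n * (p\<^sup>2 - real n) \<le> 2 * (real n - 1) * p\<^sup>2" using pp by simp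
    then have "(real n + 1) * p\<^sup>2 \<le> 2 * (real n)\<^sup>2" by (simp add: algebra_simps power2_eq_square)
    also have "\<dots> < (real n + 1) * (2 * real n + 1)" using nm by (simp add: algebra_simps power2_eq_square)
    finally show ?thesis by simp
  qed
  have decay: "psi n y \<le> psi n t * exp ((y - t) * (p - (y + t) / 2))" if "p \<le> t" "t \<le> y" for t y
  proof -
    have "?H y * exp (- p * y) \<le> ?H t * exp (- p * t)"
    proof (rule DERIV_nonpos_imp_nonincreasing[OF that(2)])
      fix x assume x: "t \<le> x" "x \<le> y"
      have "r p \<le> r x" using growth[of p x] p x that by auto
      then have "2 * real n \<le> p * r x" using rp pp by (simp add: field_simps)
      then have "2 * real n * ?G x \<le> p * ?H x" using Gpos[of x] Hr[of x] x that p(1) by simp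
      then have le: "(2 * real n * ?G x - p * ?H x) * exp (- p * x) \<le> 0" by (simp add: mult_le_0_iff)
      have "((\<lambda>x. ?H x * exp (- p * x)) has_real_derivative (2 * real n * ?G x - p * ?H x) * exp (- p * x)) (at x)"
        using hermite_deriv[of n x UNIV] n nm
        by (auto intro!: derivative_eq_intros simp: algebra_simps)
      with le show "\<exists>d. ((\<lambda>x. ?H x * exp (- p * x)) has_real_derivative d) (at x) \<and> d \<le> 0" by blast
    qed
    then have "?H y * exp (- p * y) * exp (p * y - y\<^sup>2 / 2) \<le> ?H t * exp (- p * t) * exp (p * y - y\<^sup>2 / 2)"
      by (intro mult_right_mono) auto
    then show ?thesis unfolding psi_def mult.assoc exp_add[symmetric]
      by (simp add: algebra_simps power2_eq_square add_divide_distrib diff_divide_distrib)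
  qed
  show thesis
  proof (rule that[of z p])
    show "dpsi n z > 0" "dpsi n p = 0" "psi n z = 0"
      using z(2) Gpos[of z] nm crit by (simp_all add: dpsi_def psi_def)
    show "\<And>y. y > z \<Longrightarrow> psi n y > 0" using z by (simp add: psi_def)
  qed (use z0 zp p pn pu decay in auto)
qed


text \<open>
  Exponential decay is all that summability and continuity of the lattice sums require, and it turns
  the summands into a geometric series.
\<close>

lemma psi_exp_bound:
  assumes n: "n \<ge> 4" "even n"
  obtains C where "\<And>y. \<bar>psi n y\<bar> \<le> C * exp (- \<bar>y\<bar>)"
proof -
  obtain z p where zp: "0 < z" "z < p" and pos: "\<And>y. y > z \<Longrightarrow> psi n y > 0"
    and decay: "\<And>t y. p \<le> t \<Longrightarrow> t \<le> y \<Longrightarrow> psi n y \<le> psi n t * exp ((y - t) * (p - (y + t) / 2))"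
    using hermite_profile[OF n(1)] by metis
  have "continuous_on {0..p} (\<lambda>y. \<bar>psi n y\<bar> * exp y)"
    by (intro continuous_intros continuous_on_psi)
  then have "\<exists>s\<in>{0..p}. \<forall>y\<in>{0..p}. \<bar>psi n y\<bar> * exp y \<le> \<bar>psi n s\<bar> * exp s"
    using zp by (intro continuous_attains_sup) auto
  then obtain s where s: "\<And>y. y \<in> {0..p} \<Longrightarrow> \<bar>psi n y\<bar> * exp y \<le> \<bar>psi n s\<bar> * exp s"
    by blast
  define C where "C = max (\<bar>psi n s\<bar> * exp s) (psi n p * exp (p + 1/2))"
  have half: "\<bar>psi n y\<bar> * exp y \<le> C" if "y \<ge> 0" for y
  proof (cases "y \<le> p")
    case True
    then show ?thesis using s[of y] that by (simp add: C_def)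
  next
    case False
    have pp: "psi n p > 0" using pos zp by simp
    \<comment> \<open>The Gaussian decay \<open>exp (- (y - p)\<^sup>2 / 2)\<close> is weakened to \<open>exp (1/2 - (y - p))\<close>.\<close>
    have "(y - p - 1)\<^sup>2 \<ge> 0" by simp
    then have "(y - p) * (p - (y + p) / 2) \<le> p + 1/2 - y"
      by (simp add: power2_eq_square field_simps)
    then have "psi n p * exp ((y - p) * (p - (y + p) / 2)) \<le> psi n p * exp (p + 1/2 - y)"
      using pp by simp
    then have "psi n y \<le> psi n p * exp (p + 1/2 - y)" using decay[of p y] False by simp
    then have "psi n y * exp y \<le> psi n p * exp (p + 1/2 - y) * exp y" by (intro mult_right_mono) auto
    also have "\<dots> = psi n p * exp (p + 1/2)" by (simp add: mult.assoc exp_add[symmetric])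
    finally show ?thesis using pos[of y] zp False by (simp add: C_def)
  qed
  show thesis
  proof (rule that[of C])
    fix y
    have "psi n \<bar>y\<bar> = psi n y" using psi_even[OF n(2), of y] by (simp add: abs_if)
    then have "\<bar>psi n y\<bar> * exp \<bar>y\<bar> \<le> C" using half[of "\<bar>y\<bar>"] by simp
    then show "\<bar>psi n y\<bar> \<le> C * exp (- \<bar>y\<bar>)" by (simp add: exp_minus field_simps)
  qed
qed

section \<open>Alternating sums over half-lines and over the integers\<close>

definition alt_sum :: "(real \<Rightarrow> real) \<Rightarrow> real \<Rightarrow> real \<Rightarrow> real" where
  "alt_sum f \<mu> a = (\<Sum>k. (-1) ^ k * f (\<mu> * (real k + a)))"

context
  fixes f :: "real \<Rightarrow> real" and C :: real
  assumes bound: "\<And>y. \<bar>f y\<bar> \<le> C * exp (- \<bar>y\<bar>)"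
begin

lemma C_nonneg: "C \<ge> 0"
  using bound[of 0] by simp

lemma alt_sum_term_bound:
  assumes "0 < m" "m \<le> \<mu>" "0 \<le> a"
  shows "norm ((-1) ^ k * f (\<mu> * (real k + a))) \<le> C * exp (- m) ^ k"
proof -
  have "m * real k \<le> \<mu> * (real k + a)" using assms by (intro mult_mono) auto
  then have "exp (- \<bar>\<mu> * (real k + a)\<bar>) \<le> exp (- (m * real k))" using assms by simp
  also have "\<dots> = exp (- m) ^ k" by (simp add: exp_of_nat_mult[symmetric] mult.commute)
  finally have "C * exp (- \<bar>\<mu> * (real k + a)\<bar>) \<le> C * exp (- m) ^ k"
    using C_nonneg by (intro mult_left_mono) auto
  with bound[of "\<mu> * (real k + a)"] show ?thesis
    by (simp add: abs_mult)
qed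

lemma summable_bound: "0 < m \<Longrightarrow> summable (\<lambda>k. C * exp (- m :: real) ^ k)"
  by (intro summable_mult summable_geometric) simp

lemma summable_alt_sum:
  assumes "0 < \<mu>" "0 \<le> a"
  shows "summable (\<lambda>k. norm ((-1) ^ k * f (\<mu> * (real k + a))))"
  by (rule summable_comparison_test'[OF summable_bound[OF assms(1)], of 0])
     (use alt_sum_term_bound[OF assms(1) order.refl assms(2)] in simp)

lemma alt_sum_rec:
  assumes "0 < \<mu>" "0 \<le> a"
  shows "alt_sum f \<mu> a = f (\<mu> * a) - alt_sum f \<mu> (a + 1)"
proof -
  have s: "summable (\<lambda>k. (-1) ^ k * f (\<mu> * (real k + a)))"
    using summable_alt_sum[OF assms] by (rule summable_norm_cancel)
  have s': "summable (\<lambda>k. (-1) ^ k * f (\<mu> * (real k + (a + 1))))"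
    by (rule summable_norm_cancel, rule summable_alt_sum) (use assms in auto)
  have "(-1) ^ Suc k * f (\<mu> * (real (Suc k) + a)) = - ((-1) ^ k * f (\<mu> * (real k + (a + 1))))" for k
    by (simp add: algebra_simps)
  then have "(\<Sum>k. (-1) ^ Suc k * f (\<mu> * (real (Suc k) + a))) = - alt_sum f \<mu> (a + 1)"
    unfolding alt_sum_def by (simp only: suminf_minus[OF s'])
  also have "(\<Sum>k. (-1) ^ Suc k * f (\<mu> * (real (Suc k) + a))) = alt_sum f \<mu> a - f (\<mu> * a)"
    unfolding suminf_split_head[OF s] alt_sum_def by simp
  finally show ?thesis by linarith
qed

lemma tendsto_exp_bound:
  assumes "0 < m" "0 \<le> a"
  shows "(\<lambda>k. f (m * (real k + a))) \<longlonglongrightarrow> 0"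
proof -
  have "(\<lambda>k. norm ((-1) ^ k * f (m * (real k + a)))) \<longlonglongrightarrow> 0"
    using summable_alt_sum[OF assms] by (rule summable_LIMSEQ_zero)
  then show ?thesis by (simp add: abs_mult tendsto_rabs_zero_iff)
qed

lemma alt_sum_bounds:
  assumes "0 < \<mu>" "0 \<le> a" "p \<le> \<mu> * a"
    and pos: "\<And>y. p \<le> y \<Longrightarrow> f y \<ge> 0"
    and anti: "\<And>t y. p \<le> t \<Longrightarrow> t \<le> y \<Longrightarrow> f y \<le> f t"
  shows "0 \<le> alt_sum f \<mu> a" and "alt_sum f \<mu> a \<le> f (\<mu> * a)"
proof -
  let ?b = "\<lambda>k. f (\<mu> * (real k + a))"
  have ge: "p \<le> \<mu> * (real k + a)" for k
    using assms mult_left_mono[of a "real k + a" \<mu>] by linarith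
  have b: "?b \<longlonglongrightarrow> 0" "0 \<le> ?b k" "?b (Suc k) \<le> ?b k" for k
  proof -
    show "?b \<longlonglongrightarrow> 0" by (rule tendsto_exp_bound[OF assms(1,2)])
    show "0 \<le> ?b k" by (rule pos[OF ge])
    show "?b (Suc k) \<le> ?b k" using assms(1) by (intro anti[OF ge] mult_left_mono) auto
  qed
  show "0 \<le> alt_sum f \<mu> a" "alt_sum f \<mu> a \<le> f (\<mu> * a)"
    using summable_Leibniz'(2)[OF b, of 0] summable_Leibniz'(4)[OF b, of 0]
    by (simp_all add: alt_sum_def)
qed

lemma continuous_on_alt_sum:
  assumes "0 < m" "0 \<le> a" and f: "continuous_on UNIV f"
  shows "continuous_on {m..} (\<lambda>\<mu>. alt_sum f \<mu> a)"
proof -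
  have "uniform_limit {m..} (\<lambda>N \<mu>. \<Sum>k<N. (-1) ^ k * f (\<mu> * (real k + a)))
          (\<lambda>\<mu>. alt_sum f \<mu> a) sequentially"
    unfolding alt_sum_def
    by (rule Weierstrass_m_test[OF _ summable_bound[OF assms(1)]])
       (use alt_sum_term_bound assms in auto)
  moreover have "continuous_on {m..} (\<lambda>\<mu>. \<Sum>k<N. (-1) ^ k * f (\<mu> * (real k + a)))" for N
    by (intro continuous_intros continuous_on_compose2[OF f]) auto
  ultimately show ?thesis
    by (intro uniform_limit_theorem[where F = sequentially]) auto
qed

text \<open>
  Splitting the integers into \<open>k \<ge> 0\<close> and \<open>k = - j - 1\<close>; on the second half evenness of \<open>f\<close> replaces
  \<open>x - j - 1\<close> by \<open>j + (1 - x)\<close>, and the shift by one flips the sign.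
\<close>

lemma bilateral_alt_sum:
  assumes even: "\<And>y. f (- y) = f y" and "0 < \<mu>" "0 \<le> x" "x \<le> 1"
  shows "((\<lambda>k::int. (if even k then 1 else - 1) * f (\<mu> * (x + of_int k)))
           has_sum (alt_sum f \<mu> x - alt_sum f \<mu> (1 - x))) UNIV"
proof -
  let ?g = "\<lambda>k::int. (if even k then 1 else - 1) * f (\<mu> * (x + of_int k))"
  let ?neg = "\<lambda>k::nat. - int k - 1"
  have hs: "((\<lambda>k. (-1) ^ k * f (\<mu> * (real k + a))) has_sum alt_sum f \<mu> a) UNIV" if "0 \<le> a" for a
    unfolding alt_sum_def using summable_alt_sum[OF assms(2) that]
    by (rule norm_summable_imp_has_sum)
       (rule summable_sums[OF summable_norm_cancel[OF summable_alt_sum[OF assms(2) that]]])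
  have "((?g \<circ> int) has_sum alt_sum f \<mu> x) UNIV"
    using hs[OF assms(3)] by (simp add: o_def add.commute minus_one_power_iff)
  then have 1: "(?g has_sum alt_sum f \<mu> x) (range int)"
    by (subst has_sum_reindex) auto
  have refl: "f (\<mu> * (x + of_int (?neg k))) = f (\<mu> * (real k + (1 - x)))" for k
    using even[of "\<mu> * (real k + (1 - x))"] by (simp add: algebra_simps)
  have "((\<lambda>k. - ((-1) ^ k * f (\<mu> * (real k + (1 - x))))) has_sum - alt_sum f \<mu> (1 - x)) UNIV"
    using hs[of "1 - x"] assms(4) by (subst has_sum_uminus) simp
  also have "(\<lambda>k. - ((-1) ^ k * f (\<mu> * (real k + (1 - x))))) = ?g \<circ> ?neg"
    by (rule ext) (simp add: refl[simplified] minus_one_power_iff)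
  finally have "((?g \<circ> ?neg) has_sum - alt_sum f \<mu> (1 - x)) UNIV" .
  moreover have "inj ?neg" by (auto simp: inj_on_def)
  ultimately have 2: "(?g has_sum - alt_sum f \<mu> (1 - x)) (range ?neg)"
    using has_sum_reindex by blast
  have "range int \<union> range ?neg = UNIV"
  proof -
    have "k \<in> range int \<union> range ?neg" for k
    proof (cases "k \<ge> 0")
      case False
      then have "k = ?neg (nat (- k - 1))" by simp
      then show ?thesis by blast
    qed (metis UnI1 nat_0_le rangeI)
    then show ?thesis by blast
  qed
  moreover have "range int \<inter> range ?neg = {}" by auto
  ultimately show ?thesis using has_sum_Un_disjoint[OF 1 2] by simp
qed

end

section \<open>Sign changes of the alternating sum\<close>

text \<open>
  The sign analysis sketched at the start: each case exhibits two dilations at which \<open>F\<close> has opposite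
  signs.
\<close>

lemma ex_zero_alternating_sum:
  assumes n: "n \<ge> 4" "even n" and x: "0 \<le> x" "x \<le> 1/4"
  shows "\<exists>\<mu>>0. alt_sum (psi n) \<mu> x = alt_sum (psi n) \<mu> (1 - x)"
proof -
  let ?u = "psi n"
  let ?A = "alt_sum ?u"
  define F where "F \<mu> = ?A \<mu> x - ?A \<mu> (1 - x)" for \<mu>
  obtain C where C: "\<And>y. \<bar>?u y\<bar> \<le> C * exp (- \<bar>y\<bar>)" using psi_exp_bound[OF n] by blast
  obtain z p where zp: "0 < z" "z < p" "p \<le> 2 * z" and z: "?u z = 0" "dpsi n z > 0"
    and pos: "\<And>y. y > z \<Longrightarrow> ?u y > 0" and p: "dpsi n p = 0" "real n \<le> p\<^sup>2" "p\<^sup>2 < 2 * real n + 1"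
    and decay: "\<And>t y. p \<le> t \<Longrightarrow> t \<le> y \<Longrightarrow> ?u y \<le> ?u t * exp ((y - t) * (p - (y + t) / 2))"
    using hermite_profile[OF n(1)] by metis
  have p0: "p > 0" using zp by simp
  have anti: "?u y \<le> ?u t" if "p \<le> t" "t \<le> y" for t y
  proof -
    have "(y - t) * (p - (y + t) / 2) \<le> 0" using that by (intro mult_nonneg_nonpos) auto
    then have "?u t * exp ((y - t) * (p - (y + t) / 2)) \<le> ?u t" using pos[of t] that zp by simp
    then show ?thesis using decay[OF that] by linarith
  qed
  have nonneg: "?u y \<ge> 0" if "p \<le> y" for y using pos[of y] that zp by simp
  have A_bounds: "0 \<le> ?A \<mu> a" "?A \<mu> a \<le> ?u (\<mu> * a)" if "0 < \<mu>" "0 \<le> a" "p \<le> \<mu> * a" for \<mu> a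
    by (rule alt_sum_bounds[OF C that nonneg anti]; assumption)+
  note A_rec = alt_sum_rec[OF C]
  have half: "?u y \<le> ?u p / 2" if "2 * p \<le> y" for y
  proof -
    have "exp (p\<^sup>2 / 2) \<ge> 2" using exp_ge_add_one_self[of "p\<^sup>2 / 2"] p(2) n(1) by linarith
    then have "exp (- (p\<^sup>2 / 2)) \<le> 1 / 2" by (simp add: exp_minus field_simps)
    moreover have "(2 * p - p) * (p - (2 * p + p) / 2) = - (p\<^sup>2 / 2)" by (simp add: power2_eq_square)
    ultimately have "?u p * exp ((2 * p - p) * (p - (2 * p + p) / 2)) \<le> ?u p * (1 / 2)"
      using nonneg[of p] by (intro mult_left_mono) auto
    then have "?u (2 * p) \<le> ?u p / 2" using decay[of p "2 * p"] p0 by simp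
    then show ?thesis using anti[of "2*p" y] that p0 by linarith
  qed
  have sonin_p: "\<bar>?u 0\<bar> \<le> ?u p"
    using sonin[of n p] n p p0 nonneg[of p] by (simp add: abs_le_square_iff[symmetric])
  have F_cont: "continuous_on {m..} F" if "0 < m" for m
    unfolding F_def[abs_def] using x that
    by (intro continuous_on_diff continuous_on_alt_sum[OF C] continuous_on_psi) auto
  have ivt: "\<exists>\<mu>>0. F \<mu> = 0" if ab: "0 < a" "0 < b" "F a \<le> 0" "0 \<le> F b" for a b
  proof -
    have "continuous_on (closed_segment a b) F"
      by (rule continuous_on_subset[OF F_cont[of "min a b"]]) (use ab in \<open>auto simp: closed_segment_eq_real_ivl\<close>)
    then have "connected (F ` closed_segment a b)" by (intro connected_continuous_image) auto
    then have "0 \<in> F ` closed_segment a b"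
      using ab by (auto intro: connectedD_interval[of _ "F a" "F b"])
    then obtain \<mu> where "\<mu> \<in> closed_segment a b" "F \<mu> = 0" by auto
    then show ?thesis
      using ab by (intro exI[of _ \<mu>]) (auto simp: closed_segment_eq_real_ivl split: if_splits)
  qed
  \<comment> \<open>The term \<open>k = 0\<close> is split off, leaving two alternating sums that start away from the origin.\<close>
  have F_split: "F \<mu> = ?u (\<mu> * x) - ?A \<mu> (1 + x) - ?A \<mu> (1 - x)" if "\<mu> > 0" for \<mu>
    using A_rec[of \<mu> x] that x by (simp add: F_def add.commute)
  have "\<exists>\<mu>>0. F \<mu> = 0"
  proof (cases "x = 0")
    case False
    then have x0: "x > 0" using x by simp
    \<comment> \<open>This is where \<open>x \<le> 1/4\<close> enters: \<open>1 - x \<ge> 3 * x\<close>.\<close>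
    have far: "s * 3 \<le> s / x * (1 - x)" "s * 3 \<le> s / x * (1 + x)" if "s > 0" for s
      using x x0 that by (simp_all add: field_simps)
    show ?thesis
    proof (rule ivt)
      show "F (z / x) \<le> 0"
        using F_split[of "z / x"] A_bounds(1)[of "z / x" "1 + x"] A_bounds(1)[of "z / x" "1 - x"]
          far[of z] zp z x0 x by simp
      have "?A (p / x) (1 + x) \<le> ?u (p / x * (1 + x))" "?A (p / x) (1 - x) \<le> ?u (p / x * (1 - x))"
        using far[of p] p0 x0 x A_bounds(2)[of "p / x" "1 + x"] A_bounds(2)[of "p / x" "1 - x"]
        by simp_all
      moreover have "?u (p / x * (1 + x)) \<le> ?u p / 2" "?u (p / x * (1 - x)) \<le> ?u p / 2"
        using far[of p] p0 half[of "p / x * (1 + x)"] half[of "p / x * (1 - x)"] by linarith+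
      ultimately show "0 \<le> F (p / x)" using F_split[of "p / x"] p0 x0 by simp
    qed (use zp p0 x0 in auto)
  next
    case True
    have F1: "F \<mu> = ?u 0 - 2 * ?A \<mu> 1" if "\<mu> > 0" for \<mu> using F_split[OF that] True by simp
    have F2: "F \<mu> = ?u 0 - 2 * ?u \<mu> + 2 * ?A \<mu> 2" if "\<mu> > 0" for \<mu>
      using F1[OF that] A_rec[of \<mu> 1] that by simp
    have F3: "F \<mu> = ?u 0 - 2 * ?u \<mu> + 2 * ?u (\<mu> * 2) - 2 * ?A \<mu> 3" if "\<mu> > 0" for \<mu>
      using F2[OF that] A_rec[of \<mu> 2] that by simp
    have "?u 0 \<noteq> 0" using n(2) hermite_even_0_nonzero by (auto simp: psi_def elim!: evenE)
    moreover have "\<exists>b>0. 2 * ?A b 1 < e \<and> 0 \<le> ?A b 1" if "e > 0" for e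
    proof -
      have "(\<lambda>k. ?u (1 * (real k + p))) \<longlonglongrightarrow> 0"
        using tendsto_exp_bound[OF C, of 1 p] p0 by simp
      then have "\<forall>\<^sub>F k in sequentially. ?u (1 * (real k + p)) < e / 2"
        by (rule order_tendstoD) (use that in simp)
      then obtain k where k: "?u (real k + p) < e / 2"
        by (auto simp: eventually_sequentially)
      show ?thesis
        using A_bounds[of "real k + p" 1] k p0 by (intro exI[of _ "real k + p"]) auto
    qed
    from this[of "\<bar>?u 0\<bar>"] obtain b where b: "b > 0" "2 * ?A b 1 < \<bar>?u 0\<bar>" "0 \<le> ?A b 1"
      using \<open>?u 0 \<noteq> 0\<close> by auto
    ultimately consider "?u 0 > 0" | "?u 0 < 0" by linarith
    then show ?thesis
    proof cases
      case 1
      have "?A p 2 \<le> ?u (p * 2)" using A_bounds(2)[of p 2] p0 by simp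
      also have "\<dots> \<le> ?u p / 2" using half by simp
      finally have "F p \<le> 0" using F2[OF p0] sonin_p 1 by simp
      moreover have "0 \<le> F b" using F1 b 1 by simp
      ultimately show ?thesis using ivt[of p b] p0 b by simp
    next
      case 2
      \<comment> \<open>The decay from \<open>p\<close> to \<open>3 * p / 2\<close> below has the factor \<open>exp (- p\<^sup>2 / 8)\<close>, and
          \<open>p\<^sup>2 \<ge> n\<close> makes this at most \<open>1/2\<close> for \<open>n \<ge> 6\<close> but not for \<open>n = 4\<close>.\<close>
      have "n \<noteq> 4" using 2 hermite_4_0 by (auto simp: psi_def)
      then have n6: "n \<ge> 6" using n by (auto elim!: evenE)
      have "\<exists>a>0. F a \<ge> 0"
      proof (cases "?u (p / 2) \<le> 0")
        case True
        have "exp (p\<^sup>2 / 8) \<ge> 1 + 3/4 + (3/4)\<^sup>2 / 2"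
        proof -
          have "exp (3/4 :: real) \<ge> 1 + 3/4 + (3/4)\<^sup>2 / 2" by (rule exp_lower_Taylor_quadratic) simp
          moreover have "exp (3/4 :: real) \<le> exp (p\<^sup>2 / 8)" using p(2) n6 by simp
          ultimately show ?thesis by linarith
        qed
        then have "exp (p\<^sup>2 / 8) \<ge> 2" by (simp add: power2_eq_square)
        then have "exp (- (p\<^sup>2 / 8)) \<le> 1 / 2" by (simp add: exp_minus field_simps)
        moreover have "(p / 2 * 3 - p) * (p - (p / 2 * 3 + p) / 2) = - (p\<^sup>2 / 8)"
          by (simp add: power2_eq_square field_simps)
        ultimately have "?u p * exp ((p / 2 * 3 - p) * (p - (p / 2 * 3 + p) / 2)) \<le> ?u p * (1 / 2)"
          using nonneg[of p] by (intro mult_left_mono) auto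
        then have "?u (p / 2 * 3) \<le> ?u p / 2" using decay[of p "p / 2 * 3"] p0 by simp
        moreover have "?A (p / 2) 3 \<le> ?u (p / 2 * 3)" using A_bounds(2)[of "p / 2" 3] p0 by simp
        ultimately have "F (p / 2) \<ge> 0" using F3[of "p / 2"] True sonin_p p0 by simp
        then show ?thesis using p0 by (intro exI[of _ "p / 2"]) simp
      next
        case False
        then have pz: "p / 2 < z" using zp z by (cases "p / 2 = z") auto
        have du: "(?u has_real_derivative dpsi n y) (at y)" for y
          using psi_has_derivative[of n y UNIV] n by simp
        \<comment> \<open>The zero \<open>z\<close> is simple, so \<open>u\<close> is negative just to its left; hence its minimum over
            \<open>[p / 2, z]\<close> is negative, and it is an interior critical point.\<close>
        obtain d where d: "d > 0" "\<And>h. 0 < h \<Longrightarrow> h < d \<Longrightarrow> ?u (z - h) < ?u z"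
          using DERIV_pos_inc_left[OF du z(2)] by blast
        define h where "h = min (d / 2) ((z - p / 2) / 2)"
        have h: "0 < h" "h < d" "h < z - p / 2" using d pz by (auto simp: h_def min_def field_simps)
        obtain q where q: "q \<in> {p/2..z}" "\<And>y. y \<in> {p/2..z} \<Longrightarrow> ?u q \<le> ?u y"
          using continuous_attains_inf[of "{p/2..z}" ?u] continuous_on_psi pz by auto
        have uq: "?u q < 0" using q(2)[of "z - h"] d(2)[OF h(1,2)] h z by auto
        then have q': "p / 2 < q" "q < z" using q(1) False z by (auto simp: less_le)
        have "dpsi n q = 0"
        proof (rule DERIV_local_min[OF du, of "min (q - p / 2) (z - q)"])
          show "\<forall>y. \<bar>q - y\<bar> < min (q - p / 2) (z - q) \<longrightarrow> ?u q \<le> ?u y"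
            using q(2) by (auto simp: abs_less_iff)
        qed (use q' in auto)
        moreover have "q\<^sup>2 < 2 * real n + 1"
          using p(3) power_strict_mono[of q p 2] q' zp p0 by simp
        ultimately have "\<bar>?u 0\<bar> \<le> \<bar>?u q\<bar>"
          using sonin[of n q] n q' p0 by (simp add: abs_le_square_iff)
        moreover have "?A q 2 \<ge> 0" using A_bounds(1)[of q 2] q' p0 by simp
        ultimately have "F q \<ge> 0" using F2[of q] uq q' p0 by simp
        then show ?thesis using q' p0 by (intro exI[of _ q]) simp
      qed
      moreover have "F b \<le> 0" using F1 b 2 by simp
      ultimately show ?thesis using ivt[of b] b by blast
    qed
  qed
  then show ?thesis by (simp add: F_def)
qed

section \<open>The Zak transform at half-integer frequencies\<close>

lemma gaussian_iterated_deriv: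
  "(deriv ^^ n) (\<lambda>t::real. exp (- 2 * pi * t\<^sup>2))
     = (\<lambda>x. (- sqrt (2 * pi)) ^ n * hermite n (sqrt (2 * pi) * x) * exp (- 2 * pi * x\<^sup>2))"
proof (induction n)
  case 0
  show ?case by simp
next
  case (Suc n)
  define s where "s = sqrt (2 * pi)"
  have s2: "2 * pi = s * s" by (simp add: s_def)
  have D: "((\<lambda>x. (- s) ^ n * hermite n (s * x) * exp (- 2 * pi * x\<^sup>2)) has_real_derivative
      (- s) ^ Suc n * hermite (Suc n) (s * x) * exp (- 2 * pi * x\<^sup>2)) (at x)" for x
  proof -
    let ?d = "poly (pderiv (hermite_poly n)) (s * x)"
    have d: "((\<lambda>x. hermite n (s * x)) has_real_derivative ?d * s) (at x)"
      unfolding hermite_def by (rule DERIV_chain2[OF poly_DERIV]) (auto intro!: derivative_eq_intros)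
    have H: "hermite (Suc n) (s * x) = 2 * (s * x) * hermite n (s * x) - ?d"
      by (simp add: hermite_def hermite_poly.simps(2))
    have e: "((\<lambda>x. exp (- 2 * pi * x\<^sup>2)) has_real_derivative exp (- 2 * pi * x\<^sup>2) * (- 2 * (s * s) * x)) (at x)"
      by (auto intro!: derivative_eq_intros simp: s2[symmetric])
    show ?thesis
      unfolding H by (rule DERIV_cong[OF DERIV_mult[OF DERIV_cmult[OF d] e]]) (simp add: algebra_simps)
  qed
  show ?case unfolding s_def[symmetric] funpow.simps o_def Suc[folded s_def]
    by (rule ext, rule DERIV_imp_deriv, rule D)
qed

lemma hermite_fun_eq_psi:
  "hermite_fun n x = hermite_const n powr (- 1/2) * sqrt (2 * pi) ^ n * psi n (sqrt (2 * pi) * x)"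
proof -
  let ?s = "sqrt (2 * pi)" and ?c = "hermite_const n powr (- 1/2)"
  have "hermite_fun n x = ?c * ((-1) ^ n * (- ?s) ^ n) * (hermite n (?s * x) * (exp (pi * x\<^sup>2) * exp (- 2 * pi * x\<^sup>2)))"
    unfolding hermite_fun_def gaussian_iterated_deriv by (simp only: mult_ac)
  also have "exp (pi * x\<^sup>2) * exp (- 2 * pi * x\<^sup>2) = exp (- ((?s * x)\<^sup>2) / 2)"
    by (simp add: exp_add[symmetric] power_mult_distrib)
  also have "(-1) ^ n * (- ?s) ^ n = ?s ^ n" by (simp add: power_mult_distrib[symmetric])
  finally show ?thesis by (simp only: psi_def)
qed

lemma half_integer_character:
  fixes k l :: int
  shows "exp (- 2 * of_real pi * \<i> * of_int k * of_real (1/2 + of_int l)) = ((if even k then 1 else - 1) :: complex)"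
proof -
  have period: "exp (2 * of_real pi * \<i> * of_int m) = (1 :: complex)" for m
    using exp_integer_2pi[of "of_int m"] by (simp add: mult_ac)
  show ?thesis
  proof (cases "even k")
    case True
    then obtain j where k: "k = 2 * j" by (elim evenE)
    have "- 2 * of_real pi * \<i> * of_int k * of_real (1/2 + of_int l)
        = 2 * of_real pi * \<i> * (of_int (- j * (1 + 2 * l)) :: complex)"
      by (simp add: k algebra_simps)
    then show ?thesis using True by (simp only: period if_True)
  next
    case False
    then obtain j where k: "k = 2 * j + 1" by (elim oddE)
    have "- 2 * of_real pi * \<i> * of_int k * of_real (1/2 + of_int l)
        = 2 * of_real pi * \<i> * (of_int (- j * (1 + 2 * l) - l - 1) :: complex) + of_real pi * \<i>"
      by (simp add: k algebra_simps)
    then show ?thesis using False by (simp only: period exp_add if_False) simp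
  qed
qed

lemma zak_half:
  "zak lam f x (1/2 + of_int l) =
     of_real (sqrt lam) * (\<Sum>\<^sub>\<infinity>k::int. (if even k then 1 else - 1) * f (lam * (x + of_int k)))"
  unfolding zak_def half_integer_character by (simp add: mult.commute)

text \<open>
  Shifting the summation index turns an integer translation into a sign. The two
  half-integer frequencies may differ, because \<open>exp (- 2 * pi * \<i> * k * l) = 1\<close>.
\<close>

lemma zak_half_shift:
  "zak lam f (x + of_int j) (1/2 + of_int l) = (if even j then 1 else - 1) * zak lam f x (1/2 + of_int l')"
proof -
  let ?t = "\<lambda>k::int. (if even k then 1 else - 1) * f (lam * (x + of_int k))"
  have "(\<Sum>\<^sub>\<infinity>k::int. (if even k then 1 else - 1) * f (lam * (x + of_int j + of_int k)))
      = (\<Sum>\<^sub>\<infinity>k::int. (if even j then 1 else - 1) * ?t (k + j))"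
    by (intro infsum_cong) (auto simp: algebra_simps)
  also have "\<dots> = (if even j then 1 else - 1) * (\<Sum>\<^sub>\<infinity>k::int. ?t (k + j))"
    by (rule infsum_cmult_right')
  also have "(\<Sum>\<^sub>\<infinity>k::int. ?t (k + j)) = (\<Sum>\<^sub>\<infinity>k::int. ?t k)"
    by (rule infsum_reindex_bij_betw[of "\<lambda>k. k + j" UNIV UNIV ?t])
       (rule bij_betw_byWitness[of _ "\<lambda>k. k - j"], auto)
  finally show ?thesis unfolding zak_half by (simp add: mult_ac)
qed

lemma zak_half_reflect:
  assumes "\<And>y. f (- y) = f y"
  shows "zak lam f (- x) (1/2 + of_int l) = zak lam f x (1/2 + of_int l)"
proof -
  let ?t = "\<lambda>k::int. (if even k then 1 else - 1) * f (lam * (x + of_int k))"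
  have "(\<Sum>\<^sub>\<infinity>k::int. (if even k then 1 else - 1) * f (lam * (- x + of_int k))) = (\<Sum>\<^sub>\<infinity>k::int. ?t (- k))"
    using assms[of "lam * (x + of_int (- k))" for k] by (intro infsum_cong) (auto simp: algebra_simps)
  also have "\<dots> = (\<Sum>\<^sub>\<infinity>k::int. ?t k)"
    by (rule infsum_reindex_bij_betw[of uminus UNIV UNIV ?t])
       (rule bij_betw_byWitness[of _ uminus], auto)
  finally show ?thesis unfolding zak_half by simp
qed

lemma zak_hermite_fun_half:
  assumes n: "n \<ge> 4" "even n" and "0 < lam" "0 \<le> x" "x \<le> 1"
  shows "\<exists>c. zak lam (\<lambda>t. complex_of_real (hermite_fun n t)) x (1/2 + of_int l) =
     c * of_real (alt_sum (psi n) (sqrt (2 * pi) * lam) x - alt_sum (psi n) (sqrt (2 * pi) * lam) (1 - x))"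
proof -
  obtain C where C: "\<And>y. \<bar>psi n y\<bar> \<le> C * exp (- \<bar>y\<bar>)" using psi_exp_bound[OF n] by blast
  define s where "s = sqrt (2 * pi)"
  define c where "c = hermite_const n powr (- 1/2) * s ^ n"
  define \<mu> where "\<mu> = s * lam"
  have mu: "\<mu> > 0" using assms by (simp add: \<mu>_def s_def)
  have "((\<lambda>k::int. complex_of_real ((if even k then 1 else - 1) * psi n (\<mu> * (x + of_int k)))) has_sum
     of_real (alt_sum (psi n) \<mu> x - alt_sum (psi n) \<mu> (1 - x))) UNIV"
    by (intro has_sum_of_real bilateral_alt_sum[OF C] psi_even n mu assms)
  then have sum: "(\<Sum>\<^sub>\<infinity>k::int. complex_of_real ((if even k then 1 else - 1) * psi n (\<mu> * (x + of_int k))))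
      = of_real (alt_sum (psi n) \<mu> x - alt_sum (psi n) \<mu> (1 - x))" by (rule infsumI)
  have "(\<Sum>\<^sub>\<infinity>k::int. (if even k then 1 else - 1) * complex_of_real (hermite_fun n (lam * (x + of_int k))))
     = (\<Sum>\<^sub>\<infinity>k::int. of_real c * complex_of_real ((if even k then 1 else - 1) * psi n (\<mu> * (x + of_int k))))"
    by (intro infsum_cong) (simp add: hermite_fun_eq_psi c_def s_def \<mu>_def mult_ac)
  also have "\<dots> = of_real c * of_real (alt_sum (psi n) \<mu> x - alt_sum (psi n) \<mu> (1 - x))"
    unfolding infsum_cmult_right' sum ..
  finally show ?thesis unfolding zak_half s_def[symmetric] \<mu>_def[symmetric] by (metis mult.assoc)
qed

theorem lemma4p10:
  fixes n :: nat and x0 :: real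
  assumes "n \<ge> 4" and "even n"
    and "x0 \<in> {a + of_int m | (a::real) (m::int). a \<in> {-1/4..1/4}}"
  shows "\<exists>lam>0. zak lam (\<lambda>t. complex_of_real (hermite_fun n t)) x0 (1/2) = 0 \<and>
    (\<forall>k l :: int.
       zak lam (\<lambda>t. complex_of_real (hermite_fun n t)) (x0 + of_int k) (1/2 + of_int l) = 0 \<and>
       zak lam (\<lambda>t. complex_of_real (hermite_fun n t)) (- x0 + of_int k) (1/2 + of_int l) = 0)"
proof -
  let ?h = "\<lambda>t. complex_of_real (hermite_fun n t)"
  obtain a m where a: "x0 = a + of_int m" "\<bar>a\<bar> \<le> 1/4" using assms(3) by auto
  obtain \<mu> where \<mu>: "\<mu> > 0" "alt_sum (psi n) \<mu> \<bar>a\<bar> = alt_sum (psi n) \<mu> (1 - \<bar>a\<bar>)"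
    using ex_zero_alternating_sum[OF assms(1,2), of "\<bar>a\<bar>"] a by auto
  define lam where "lam = \<mu> / sqrt (2 * pi)"
  have lam: "lam > 0" "sqrt (2 * pi) * lam = \<mu>" using \<mu> by (simp_all add: lam_def)
  have even: "?h (- y) = ?h y" for y
    using psi_even[OF assms(2), of "sqrt (2 * pi) * y"] by (simp add: hermite_fun_eq_psi)
  note reflect = zak_half_reflect[of ?h, OF even]
  have "zak lam ?h \<bar>a\<bar> (1/2 + of_int l) = 0" for l
    using zak_hermite_fun_half[OF assms(1,2) lam(1), of "\<bar>a\<bar>" l] a(2) \<mu>(2) lam(2) by auto
  then have "zak lam ?h a (1/2 + of_int l) = 0" "zak lam ?h (- a) (1/2 + of_int l) = 0" for l
    using reflect[of lam a l] by (cases "a < 0"; metis abs_of_neg abs_of_nonneg not_less)+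
  then have "zak lam ?h (a + of_int j) (1/2 + of_int l) = 0" "zak lam ?h (- a + of_int j) (1/2 + of_int l) = 0" for j l
    unfolding zak_half_shift[where l' = l] by simp_all
  from this(1)[of "m + k" for k] this(2)[of "- m + k" for k]
  have all: "zak lam ?h (x0 + of_int k) (1/2 + of_int l) = 0"
            "zak lam ?h (- x0 + of_int k) (1/2 + of_int l) = 0" for k l
    unfolding a(1) by (simp_all add: algebra_simps)
  from all(1)[of 0 0] all lam(1) show ?thesis by (intro exI[of _ lam]) simp
qed

end
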